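(* As formal power series, \[ \sum_{n\ge 1} \left(\sum_{\sigma\in\mathcal{D}_n} (-1)^{\mathsf{inv}(\sigma)} s^{\mathsf{exc}(\sigma)} t^{\mathsf{depth}(\sigma)}\right)z^n=\sum_{k\ge 1} (-1)^k\left(\sum_{i=0}^{k-1}\binom{k-1}{i} s^{1+i}(1+s)^{k-1-i}z^{k+1+i} \right)t^k. \]
   Context: $\mathcal{D}_n$ is the set of derangements of $[n]=\{1,\dots,n\}$, i.e. permutations $\sigma=\sigma(1)\cdots\sigma(n)$ with $\sigma(i)\ne i$ for all $i$. $\mathsf{inv}(\sigma)$ is the number of pairs $(i,j)$ with $1\le i<j\le n$ and $\sigma(i)>\sigma(j)$. $\mathsf{exc}(\sigma)$ is the number of indices $i$ with $\sigma(i)>i$. $\mathsf{depth}(\sigma)=\sum_{i:\sigma(i)>i}(\sigma(i)-i)$. $s,t,z$ are indeterminates. *)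

theory Defs
  imports
    "HOL-Analysis.Analysis"
    "HOL-Combinatorics.Permutations"
    "HOL-Computational_Algebra.Formal_Power_Series"
begin

text \<open>A permutation of \<open>[n]\<close> is a function \<open>nat \<Rightarrow> nat\<close> that permutes \<open>{1..n}\<close> in the sense of
  \<^const>\<open>permutes\<close>, i.e. it is extended by the identity outside \<open>{1..n}\<close>. The fixed-point condition
  is therefore restricted to \<open>{1..n}\<close>, and \<open>n\<close> is a parameter of the statistics.\<close>

definition derangements :: "nat \<Rightarrow> (nat \<Rightarrow> nat) set" where
  "derangements n = {\<sigma>. \<sigma> permutes {1..n} \<and> (\<forall>i\<in>{1..n}. \<sigma> i \<noteq> i)}"

definition inv_stat :: "nat \<Rightarrow> (nat \<Rightarrow> nat) \<Rightarrow> nat" where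
  "inv_stat n \<sigma> = card {(i, j). 1 \<le> i \<and> i < j \<and> j \<le> n \<and> \<sigma> i > \<sigma> j}"

definition exc_stat :: "nat \<Rightarrow> (nat \<Rightarrow> nat) \<Rightarrow> nat" where
  "exc_stat n \<sigma> = card {i \<in> {1..n}. \<sigma> i > i}"

definition depth_stat :: "nat \<Rightarrow> (nat \<Rightarrow> nat) \<Rightarrow> nat" where
  "depth_stat n \<sigma> = (\<Sum>i | i \<in> {1..n} \<and> \<sigma> i > i. \<sigma> i - i)"

text \<open>The ring of formal power series in \<open>s\<close>, \<open>t\<close>, \<open>z\<close> over the integers, as iterated power series:
  \<open>s\<close> is the innermost variable and \<open>z\<close> the outermost one. The library's metric on the outermost
  \<open>fps\<close> is the \<open>z\<close>-adic one; convergence with respect to it implies coefficientwise convergence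
  in all three variables, with the same limit.\<close>

type_synonym fps_stz = "int fps fps fps"

definition var_s :: fps_stz where "var_s = fps_const (fps_const fps_X)"
definition var_t :: fps_stz where "var_t = fps_const fps_X"
definition var_z :: fps_stz where "var_z = fps_X"

end

theory Submission
  imports Defs "Jordan_Normal_Form.Determinant"
begin

text \<open>Since \<open>(-1)\<^sup>i\<^sup>n\<^sup>v\<close> is the sign, the inner sum \<open>D\<^sub>n\<close> is the determinant of the \<open>n \<times> n\<close> matrix
  with entries \<open>0\<close> on, \<open>1\<close> below and \<open>s t\<^bsup>j-i\<^esup>\<close> above the diagonal. One row and one column operation
  make its last row and column tridiagonal, so that
  \<open>D\<^sub>n\<^sub>+\<^sub>2 = -t(1+s) D\<^sub>n\<^sub>+\<^sub>1 - st D\<^sub>n\<close> with \<open>D\<^sub>0 = 1\<close> and \<open>D\<^sub>1 = 0\<close>. Hence the series \<open>S\<close> on the left satisfies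
  \<open>S = -stz\<^sup>2 + zqS\<close> with \<open>q = -t(1+s+sz)\<close>, whose geometric solution \<open>\<Sum>\<^sub>k -stz\<^sup>2 (zq)\<^bsup>k-1\<^esup>\<close> is the right-hand
  side after binomial expansion.\<close>

section \<open>Inversion parity and the sign of a permutation\<close>

text \<open>A product over pairs, unlike a power of a count, can be split factorwise and
  reindexed.\<close>

definition inversion_sign :: "nat \<Rightarrow> (nat \<Rightarrow> nat) \<Rightarrow> int" where
  "inversion_sign n p = (\<Prod>(i, j) | 1 \<le> i \<and> i < j \<and> j \<le> n. if p i > p j then - 1 else 1)"

lemma finite_pairs: "finite {(i, j). 1 \<le> i \<and> i < j \<and> j \<le> (n::nat)}"
  by (rule finite_subset[of _ "{..n} \<times> {..n}"]) auto

lemma inversion_sign_eq: "inversion_sign n p = (- 1) ^ inv_stat n p"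
proof -
  have "inversion_sign n p
      = (\<Prod>x | x \<in> {(i, j). 1 \<le> i \<and> i < j \<and> j \<le> n} \<and> (case x of (i, j) \<Rightarrow> p i > p j). - 1)"
    unfolding inversion_sign_def
    by (subst prod.inter_filter[OF finite_pairs]) (auto intro!: prod.cong)
  also have "\<dots> = (- 1) ^ inv_stat n p"
    unfolding inv_stat_def prod_constant
    by (rule arg_cong[where f = "\<lambda>S. (- 1) ^ card S"]) auto
  finally show ?thesis .
qed

text \<open>\<open>q\<close> permutes the two-element subsets of \<open>{1..n}\<close>, and
  \<open>p \<circ> q\<close> inverts a pair iff exactly one of these happens: \<open>q\<close>
  inverts it, or \<open>p\<close> inverts its image.\<close>

lemma inversion_sign_compose:
  assumes p: "p permutes {1..n}" and q: "q permutes {1..n}"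
  shows "inversion_sign n (p \<circ> q) = inversion_sign n p * inversion_sign n q"
proof -
  define P where "P = {(i, j). 1 \<le> i \<and> i < j \<and> j \<le> n}"
  define sgnp :: "(nat \<Rightarrow> nat) \<Rightarrow> nat \<times> nat \<Rightarrow> int"
    where "sgnp r = (\<lambda>(i, j). if r i > r j then - 1 else 1)" for r
  \<comment> \<open>The action of \<open>r\<close> on two-element subsets, each stored as an
    increasing pair.\<close>
  define \<phi> where "\<phi> r = (\<lambda>(i, j). (min (r i) (r j), max (r i) (r j)))" for r :: "nat \<Rightarrow> nat"
  have into: "\<phi> r x \<in> P" if "x \<in> P" "r permutes {1..n}" for r x
  proof -
    obtain i j where x: "x = (i, j)" "1 \<le> i" "i < j" "j \<le> n"
      using \<open>x \<in> P\<close> by (auto simp: P_def)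
    have "r i \<in> {1..n}" "r j \<in> {1..n}"
      using x permutes_in_image[OF that(2)] by auto
    moreover have "r i \<noteq> r j"
      using x permutes_inj[OF that(2)] by (auto dest: injD)
    ultimately show ?thesis
      using x by (auto simp: P_def \<phi>_def min_def max_def)
  qed
  have inv: "\<phi> r (\<phi> r' x) = x" if "x \<in> P" "\<And>i. r (r' i) = i" for r r' x
    using that by (auto simp: P_def \<phi>_def min_def max_def)
  have bij: "bij_betw (\<phi> q) P P"
    by (rule bij_betw_byWitness[where f' = "\<phi> (inv_into UNIV q)"])
      (use into q permutes_inv[OF q] inv permutes_inverses[OF q] in auto)
  \<comment> \<open>Sorting swaps the two image entries exactly when \<open>q\<close> inverts the
    pair, and this flips the factor of \<open>p\<close>.\<close>
  have "sgnp (p \<circ> q) x = sgnp p (\<phi> q x) * sgnp q x" if "x \<in> P" for x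
  proof -
    obtain i j where x: "x = (i, j)" "i < j"
      using \<open>x \<in> P\<close> by (auto simp: P_def)
    have "q i \<noteq> q j"
      using x permutes_inj[OF q] by (auto dest: injD)
    hence "p (q i) \<noteq> p (q j)"
      using permutes_inj[OF p] by (auto dest: injD)
    thus ?thesis
      using x \<open>q i \<noteq> q j\<close> by (auto simp: sgnp_def \<phi>_def min_def max_def)
  qed
  hence "prod (sgnp (p \<circ> q)) P = prod (sgnp p \<circ> \<phi> q) P * prod (sgnp q) P"
    by (simp add: prod.distrib[symmetric] cong: prod.cong)
  also have "prod (sgnp p \<circ> \<phi> q) P = prod (sgnp p) P"
    using prod.reindex_bij_betw[OF bij, of "sgnp p"] by (simp add: o_def)
  finally show ?thesis
    unfolding inversion_sign_def P_def sgnp_def .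
qed

lemma inversion_sign_transpose:
  assumes "a \<in> {1..n}" "b \<in> {1..n}" "a < b"
  shows "inversion_sign n (Transposition.transpose a b) = - 1"
proof -
  \<comment> \<open>The pair \<open>(a, b)\<close> is counted in the first set only, so the total is
    odd.\<close>
  have "{(i, j). 1 \<le> i \<and> i < j \<and> j \<le> n \<and> Transposition.transpose a b i > Transposition.transpose a b j}
      = Pair a ` {a<..b} \<union> (\<lambda>i. (i, b)) ` {a<..<b}" (is "?I = ?A \<union> ?B")
    using assms by (auto simp: Transposition.transpose_def image_iff split: if_splits)
  moreover have "card (?A \<union> ?B) = card ?A + card ?B"
    by (rule card_Un_disjoint) auto
  moreover have "card ?A = b - a" "card ?B = b - a - 1"
    by (simp_all add: card_image inj_on_def)
  ultimately have "inv_stat n (Transposition.transpose a b) = 2 * (b - a - 1) + 1"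
    using assms by (simp add: inv_stat_def)
  thus ?thesis
    by (simp add: inversion_sign_eq)
qed

text \<open>Both sides are multiplicative and equal -1 on transpositions, which generate all
  permutations.\<close>

lemma sign_eq_inv_stat:
  assumes "p permutes {1..n}"
  shows "sign p = (- 1) ^ inv_stat n p"
proof -
  have "inversion_sign n p = sign p"
    using assms finite_atLeastAtMost
  proof (induction rule: permutes_induct)
    case id
    show ?case
      by (auto simp: inversion_sign_def intro!: prod.neutral)
  next
    case (swap a b p)
    have "inversion_sign n (Transposition.transpose a b) = - 1"
      using swap inversion_sign_transpose[of a n b] inversion_sign_transpose[of b n a]
      by (cases a b rule: linorder_cases) (auto simp: transpose_commute)
    moreover have "Transposition.transpose a b permutes {1..n}"
      using swap by (intro permutes_swap_id)
    moreover have "permutation p"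
      using swap by (auto simp: permutation_permutes)
    ultimately show ?case
      using inversion_sign_compose[of "Transposition.transpose a b" n p]
        sign_compose[of "Transposition.transpose a b" p] swap
      by (simp only: permutation_swap_id sign_swap_id if_False)
  qed
  thus ?thesis
    by (simp add: inversion_sign_eq)
qed

section \<open>The determinant and its three-term recurrence\<close>

text \<open>Expansion along the last row leaves two cofactors; the off-diagonal one is expanded
  again along its last column.\<close>

lemma det_last_corner:
  fixes f :: "nat \<Rightarrow> nat \<Rightarrow> 'a :: comm_ring_1"
  assumes row: "\<And>j. j < n \<Longrightarrow> f (Suc n) j = 0" and col: "\<And>i. i < n \<Longrightarrow> f i (Suc n) = 0"
  defines "M \<equiv> \<lambda>m. mat m m (\<lambda>(i, j). f i j)"
  shows "Determinant.det (M (Suc (Suc n))) = f (Suc n) (Suc n) * Determinant.det (M (Suc n))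
    - f n (Suc n) * f (Suc n) n * Determinant.det (M n)"
proof -
  let ?N = "Suc (Suc n)"
  \<comment> \<open>With column \<open>n\<close> deleted, the last column of \<open>A\<close> is the
    truncated column \<open>Suc n\<close>, which can be nonzero only in row
    \<open>n\<close>.\<close>
  define A where "A = mat_delete (M ?N) (Suc n) n"
  have A: "A \<in> carrier_mat (Suc n) (Suc n)"
    by (auto simp: A_def M_def)
  have A_col: "A $$ (i, n) = f i (Suc n)" if "i \<le> n" for i
    using that by (simp add: A_def M_def mat_delete_def)
  have del: "mat_delete A n n = M n" "mat_delete (M ?N) (Suc n) (Suc n) = M (Suc n)"
    by (auto simp: A_def M_def mat_delete_def)
  have "Determinant.det A = (\<Sum>i<Suc n. A $$ (i, n) * cofactor A i n)"
    by (rule laplace_expansion_column[OF A]) simp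
  also have "\<dots> = f n (Suc n) * Determinant.det (M n)"
    by (simp add: A_col col cofactor_def del)
  finally have det_A: "Determinant.det A = f n (Suc n) * Determinant.det (M n)" .
  have "Determinant.det (M ?N) = (\<Sum>j<?N. M ?N $$ (Suc n, j) * cofactor (M ?N) (Suc n) j)"
    by (rule laplace_expansion_row) (auto simp: M_def)
  also have "\<dots> = (\<Sum>j<?N. f (Suc n) j * cofactor (M ?N) (Suc n) j)"
    by (intro sum.cong) (auto simp: M_def)
  also have "\<dots> = f (Suc n) n * cofactor (M ?N) (Suc n) n
      + f (Suc n) (Suc n) * cofactor (M ?N) (Suc n) (Suc n)"
    by (simp add: row)
  also have "cofactor (M ?N) (Suc n) n = - Determinant.det A"
    by (simp add: cofactor_def A_def)
  also have "cofactor (M ?N) (Suc n) (Suc n) = Determinant.det (M (Suc n))"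
    by (simp add: cofactor_def del)
  finally show ?thesis
    by (simp add: det_A algebra_simps)
qed

text \<open>Index \<open>0\<close> borders the matrix by a unit row and column. This forces a permutation of \<open>{0..n}\<close> in the
  expansion of the determinant to fix \<open>0\<close>, so that no shift from \<open>{0..<n}\<close> to \<open>{1..n}\<close> is needed.\<close>

definition derangement_weight :: "'a :: comm_ring_1 \<Rightarrow> 'a \<Rightarrow> nat \<Rightarrow> nat \<Rightarrow> 'a" where
  "derangement_weight s t i j =
    (if i = 0 then (if j = 0 then 1 else 0) else if j = 0 \<or> i = j then 0
     else if i < j then s * t ^ (j - i) else 1)"

definition derangement_mat :: "'a :: comm_ring_1 \<Rightarrow> 'a \<Rightarrow> nat \<Rightarrow> 'a mat" where
  "derangement_mat s t n = mat n n (\<lambda>(i, j). derangement_weight s t i j)"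

definition derangement_poly :: "'a :: comm_ring_1 \<Rightarrow> 'a \<Rightarrow> nat \<Rightarrow> 'a" where
  "derangement_poly s t n = (\<Sum>\<sigma>\<in>derangements n.
    (- 1) ^ inv_stat n \<sigma> * s ^ exc_stat n \<sigma> * t ^ depth_stat n \<sigma>)"

text \<open>Each excedance contributes one \<open>s\<close> and its height as a power of
  \<open>t\<close>; all other positions contribute 1.\<close>

lemma prod_derangement_weight:
  assumes "\<sigma> \<in> derangements n"
  shows "(\<Prod>i = 0..n. derangement_weight s t i (\<sigma> i)) = s ^ exc_stat n \<sigma> * t ^ depth_stat n \<sigma>"
proof -
  have perm: "\<sigma> permutes {1..n}" and fix_free: "\<And>i. i \<in> {1..n} \<Longrightarrow> \<sigma> i \<noteq> i"
    using assms by (auto simp: derangements_def)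
  have "\<sigma> 0 = 0"
    using perm by (auto simp: permutes_def)
  hence "(\<Prod>i = 0..n. derangement_weight s t i (\<sigma> i))
      = (\<Prod>i\<in>{1..n}. derangement_weight s t i (\<sigma> i))"
    by (simp add: prod.atLeast_Suc_atMost derangement_weight_def)
  also have "\<dots> = (\<Prod>i\<in>{1..n}. if i < \<sigma> i then s * t ^ (\<sigma> i - i) else 1)"
  proof (rule prod.cong)
    fix i assume "i \<in> {1..n}"
    moreover from this have "\<sigma> i \<in> {1..n}"
      using permutes_in_image[OF perm] by blast
    ultimately show "derangement_weight s t i (\<sigma> i) = (if i < \<sigma> i then s * t ^ (\<sigma> i - i) else 1)"
      using fix_free[of i] by (auto simp: derangement_weight_def)
  qed simp
  also have "\<dots> = (\<Prod>i | i \<in> {1..n} \<and> i < \<sigma> i. s * t ^ (\<sigma> i - i))"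
    by (rule prod.inter_filter[symmetric]) simp
  also have "\<dots> = s ^ exc_stat n \<sigma> * t ^ depth_stat n \<sigma>"
    by (simp add: prod.distrib exc_stat_def depth_stat_def power_sum)
  finally show ?thesis .
qed

text \<open>In the Leibniz expansion the sign is the inversion parity, and every permutation other
  than a derangement meets a zero entry.\<close>

lemma det_derangement_mat:
  "Determinant.det (derangement_mat s t (Suc n)) = derangement_poly s t n"
proof -
  let ?w = "\<lambda>\<sigma>. signof \<sigma> * (\<Prod>i = 0..n. derangement_weight s t i (\<sigma> i))"
  have "Determinant.det (derangement_mat s t (Suc n)) = (\<Sum>\<sigma> | \<sigma> permutes {0..n}. ?w \<sigma>)"
  proof -
    have "Determinant.det (derangement_mat s t (Suc n)) = (\<Sum>\<sigma> | \<sigma> permutes {0..<Suc n}.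
        signof \<sigma> * (\<Prod>i = 0..<Suc n. derangement_mat s t (Suc n) $$ (i, \<sigma> i)))"
      by (rule det_def') (simp add: derangement_mat_def)
    also have "\<dots> = (\<Sum>\<sigma> | \<sigma> permutes {0..<Suc n}.
        signof \<sigma> * (\<Prod>i = 0..<Suc n. derangement_weight s t i (\<sigma> i)))"
    proof (intro sum.cong arg_cong2[where f = times] prod.cong refl)
      fix \<sigma> i assume "\<sigma> \<in> {\<sigma>. \<sigma> permutes {0..<Suc n}}" "i \<in> {0..<Suc n}"
      moreover from this have "\<sigma> i \<in> {0..<Suc n}"
        using permutes_in_image[of \<sigma> "{0..<Suc n}"] by blast
      ultimately show "derangement_mat s t (Suc n) $$ (i, \<sigma> i) = derangement_weight s t i (\<sigma> i)"
        by (simp add: derangement_mat_def)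
    qed
    finally show ?thesis
      by (simp add: atLeastLessThanSuc_atLeastAtMost)
  qed
  also have "\<dots> = (\<Sum>\<sigma>\<in>derangements n. ?w \<sigma>)"
  proof (rule sum.mono_neutral_right)
    show "finite {\<sigma>. \<sigma> permutes {0..n}}"
      by (rule finite_permutations) simp
    show "derangements n \<subseteq> {\<sigma>. \<sigma> permutes {0..n}}"
      by (auto simp: derangements_def intro: permutes_subset)
    show "\<forall>\<sigma> \<in> {\<sigma>. \<sigma> permutes {0..n}} - derangements n. ?w \<sigma> = 0"
    proof
      fix \<sigma> assume \<sigma>: "\<sigma> \<in> {\<sigma>. \<sigma> permutes {0..n}} - derangements n"
      \<comment> \<open>Either \<open>0\<close> is moved, and row 0 vanishes off the diagonal, or
        some \<open>i \<ge> 1\<close> is fixed, and that diagonal entry vanishes.\<close>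
      have "\<exists>i\<in>{0..n}. derangement_weight s t i (\<sigma> i) = 0"
      proof (cases "\<sigma> 0 = 0")
        case True
        have "\<sigma> permutes {1..n}"
        proof (rule permutes_superset)
          show "\<sigma> permutes {0..n}"
            using \<sigma> by simp
          show "\<sigma> x = x" if "x \<in> {0..n} - {1..n}" for x
            using that True by (cases "x = 0") auto
        qed
        then obtain i where "i \<in> {1..n}" "\<sigma> i = i"
          using \<sigma> by (auto simp: derangements_def)
        thus ?thesis
          by (intro bexI[of _ i]) (auto simp: derangement_weight_def)
      next
        case False
        thus ?thesis
          by (intro bexI[of _ 0]) (auto simp: derangement_weight_def)
      qed
      hence "(\<Prod>i = 0..n. derangement_weight s t i (\<sigma> i)) = 0"
        by (intro prod_zero) auto
      thus "?w \<sigma> = 0"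
        by simp
    qed
  qed
  also have "\<dots> = derangement_poly s t n"
    unfolding derangement_poly_def
  proof (rule sum.cong)
    fix \<sigma> assume \<sigma>: "\<sigma> \<in> derangements n"
    hence "sign \<sigma> = (- 1) ^ inv_stat n \<sigma>"
      by (auto simp: derangements_def sign_eq_inv_stat)
    thus "?w \<sigma> = (- 1) ^ inv_stat n \<sigma> * s ^ exc_stat n \<sigma> * t ^ depth_stat n \<sigma>"
      using prod_derangement_weight[OF \<sigma>, of s t] by (simp add: mult.assoc)
  qed simp
  finally show ?thesis .
qed

lemma derangement_poly_0: "derangement_poly s t 0 = 1"
proof -
  have "Determinant.det (derangement_mat s t (Suc 0)) = derangement_mat s t (Suc 0) $$ (0, 0)"
    by (rule det_single) (simp add: derangement_mat_def)
  thus ?thesis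
    unfolding det_derangement_mat by (simp add: derangement_mat_def derangement_weight_def)
qed

lemma derangement_poly_1: "derangement_poly s t (Suc 0) = 0"
proof -
  have "derangements (Suc 0) = {}"
    by (auto simp: derangements_def permutes_def)
  thus ?thesis
    by (simp add: derangement_poly_def)
qed

text \<open>Subtracting from the last row the row before it, and from the last column \<open>t\<close> times the
  column before it, leaves only the three corner entries in the last row and column.\<close>

lemma derangement_poly_rec:
  "derangement_poly s t (Suc (Suc n)) =
    - t * (1 + s) * derangement_poly s t (Suc n) - s * t * derangement_poly s t n"
proof -
  let ?N = "Suc (Suc (Suc n))"
  let ?l = "Suc (Suc n)"
  let ?w = "derangement_weight s t"
  \<comment> \<open>\<open>g\<close> gives the entries after the row operation, \<open>f\<close>
    those after the column operation as well.\<close>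
  define g where "g i j = (if i = ?l then ?w i j - ?w (Suc n) j else ?w i j)" for i j
  define f where "f i j = (if j = ?l then g i j - t * g i (Suc n) else g i j)" for i j
  define B where "B = addrow (- 1) ?l (Suc n) (derangement_mat s t ?N)"
  have car: "derangement_mat s t ?N \<in> carrier_mat ?N ?N"
    by (simp add: derangement_mat_def)
  hence B_car: "B \<in> carrier_mat ?N ?N"
    by (simp add: B_def)
  have "addcol (- t) ?l (Suc n) B = mat ?N ?N (\<lambda>(i, j). f i j)"
    by (rule eq_matI) (auto simp: B_def derangement_mat_def f_def g_def)
  moreover have "Determinant.det (addcol (- t) ?l (Suc n) B) = Determinant.det B"
    by (rule det_addcol[OF _ _ B_car]) auto
  moreover have "Determinant.det B = Determinant.det (derangement_mat s t ?N)"
    unfolding B_def by (rule det_addrow[OF _ _ car]) auto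
  ultimately have "derangement_poly s t ?l = Determinant.det (mat ?N ?N (\<lambda>(i, j). f i j))"
    by (simp add: det_derangement_mat)
  also have "\<dots> = f ?l ?l * Determinant.det (mat ?l ?l (\<lambda>(i, j). f i j))
      - f (Suc n) ?l * f ?l (Suc n) * Determinant.det (mat (Suc n) (Suc n) (\<lambda>(i, j). f i j))"
  proof (rule det_last_corner)
    show "f ?l j = 0" if "j < Suc n" for j
      using that by (auto simp: f_def g_def derangement_weight_def)
    \<comment> \<open>For \<open>i \<ge> 1\<close> the two terms are \<open>s * t ^ (?l - i)\<close>
      and \<open>t * (s * t ^ (Suc n - i))\<close>; row 0 is zero in both columns.\<close>
    show "f i ?l = 0" if "i < Suc n" for i
      using that by (auto simp: f_def g_def derangement_weight_def Suc_diff_le)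
  qed
  also have "mat ?l ?l (\<lambda>(i, j). f i j) = derangement_mat s t ?l"
    by (auto simp: derangement_mat_def f_def g_def)
  also have "mat (Suc n) (Suc n) (\<lambda>(i, j). f i j) = derangement_mat s t (Suc n)"
    by (auto simp: derangement_mat_def f_def g_def)
  \<comment> \<open>The row operation turns the corner 0 into \<open>- s * t\<close> and the entry
    to its left into 1; the column operation then subtracts \<open>t\<close>.\<close>
  also have "f ?l ?l = - t * (1 + s)"
    by (simp add: f_def g_def derangement_weight_def algebra_simps)
  also have "f (Suc n) ?l = s * t"
    by (simp add: f_def g_def derangement_weight_def)
  also have "f ?l (Suc n) = 1"
    by (simp add: f_def g_def derangement_weight_def)
  finally show ?thesis
    by (simp add: det_derangement_mat)
qed

section \<open>Coefficients and convergence of formal power series\<close>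

text \<open>This turns the inner sum of the theorem, taken in the outermost ring, into a genuine
  coefficient of a power of \<open>z\<close>.\<close>

lemma derangement_poly_fps_const:
  fixes s t :: "'a :: comm_ring_1"
  shows "derangement_poly (fps_const s) (fps_const t) n = fps_const (derangement_poly s t n)"
proof -
  have neg_one_power: "(- 1 :: 'a fps) ^ k = fps_const ((- 1) ^ k)" for k
    by (metis fps_const_1_eq_1 fps_const_neg fps_const_power)
  have "derangement_poly (fps_const s) (fps_const t) n = (\<Sum>\<sigma>\<in>derangements n.
      fps_const ((- 1) ^ inv_stat n \<sigma> * s ^ exc_stat n \<sigma> * t ^ depth_stat n \<sigma>))"
    by (simp only: derangement_poly_def neg_one_power fps_const_power fps_const_mult)
  thus ?thesis
    by (simp add: derangement_poly_def fps_eq_iff fps_sum_nth)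
qed

text \<open>Term \<open>k\<close> has order at least \<open>k\<close>, so only finitely many terms
  reach a given coefficient.\<close>

lemma has_sum_fps_nthI:
  fixes F :: "nat \<Rightarrow> 'a :: ab_group_add fps"
  assumes small: "\<And>k n. k \<in> A \<Longrightarrow> n < k \<Longrightarrow> fps_nth (F k) n = 0"
    and sum: "\<And>n. fps_nth S n = (\<Sum>k\<in>A \<inter> {..n}. fps_nth (F k) n)"
  shows "(F has_sum S) A"
proof (rule has_sum_fpsI)
  fix n
  have sub: "{k \<in> A. fps_nth (F k) n \<noteq> 0} \<subseteq> A \<inter> {..n}"
    using small by (auto simp: not_less[symmetric])
  thus "finite {k \<in> A. fps_nth (F k) n \<noteq> 0}"
    by (rule finite_subset) simp
  show "fps_nth S n = (\<Sum>k | k \<in> A \<and> fps_nth (F k) n \<noteq> 0. fps_nth (F k) n)"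
    unfolding sum by (rule sum.mono_neutral_right) (use sub in auto)
qed

text \<open>Substituting the equation into itself \<open>n\<close> times gives a partial geometric
  sum with remainder \<open>(fps_X * q) ^ n * S\<close>.\<close>

lemma has_sum_fps_geometric:
  fixes S c q :: "'a :: comm_ring_1 fps"
  assumes S: "S = fps_X * c + fps_X * q * S"
  shows "((\<lambda>k. fps_X * c * (fps_X * q) ^ (k - 1)) has_sum S) {1..}"
proof (rule has_sum_fps_nthI)
  fix k n :: nat
  assume "k \<in> {1..}" "n < k"
  hence "fps_X * c * (fps_X * q) ^ (k - 1) = fps_X ^ k * (c * q ^ (k - 1))"
    by (cases k) (auto simp: power_mult_distrib algebra_simps)
  thus "fps_nth (fps_X * c * (fps_X * q) ^ (k - 1)) n = 0"
    using \<open>n < k\<close> by (simp add: fps_X_power_mult_nth)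
next
  fix n :: nat
  \<comment> \<open>The power in the remainder only guarantees order \<open>n\<close>; the zero
    constant term of \<open>S\<close> makes coefficient \<open>n\<close> vanish too.\<close>
  have S0: "fps_nth S 0 = 0"
    by (subst S) (simp add: mult.assoc)
  have "S = (\<Sum>k=1..n. fps_X * c * (fps_X * q) ^ (k - 1)) + (fps_X * q) ^ n * S"
  proof (induction n)
    case (Suc n)
    have "(fps_X * q) ^ n * S = fps_X * c * (fps_X * q) ^ n + (fps_X * q) ^ Suc n * S"
      by (subst S) (simp add: algebra_simps)
    thus ?case
      using Suc by (simp add: algebra_simps)
  qed simp
  moreover have "fps_nth ((fps_X * q) ^ n * S) n = 0"
    by (simp add: power_mult_distrib mult.assoc fps_X_power_mult_nth S0)
  ultimately have "fps_nth S n = fps_nth (\<Sum>k=1..n. fps_X * c * (fps_X * q) ^ (k - 1)) n"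
    by (metis add.right_neutral fps_add_nth)
  moreover have "{1..} \<inter> {..n} = {1..n}"
    by auto
  ultimately show "fps_nth S n
      = (\<Sum>k\<in>{1..} \<inter> {..n}. fps_nth (fps_X * c * (fps_X * q) ^ (k - 1)) n)"
    by (simp add: fps_sum_nth)
qed

section \<open>The generating function and its expansion by depth\<close>

text \<open>The constant term is 0, not \<open>derangement_poly s t 0\<close>, because the sum
  starts at 1.\<close>

definition derangement_gf :: "'a :: comm_ring_1 \<Rightarrow> 'a \<Rightarrow> 'a fps" where
  "derangement_gf s t = Abs_fps (\<lambda>n. if n = 0 then 0 else derangement_poly s t n)"

lemma has_sum_derangement_gf:
  "((\<lambda>n. fps_const (derangement_poly s t n) * fps_X ^ n) has_sum derangement_gf s t) {1..}"
proof (rule has_sum_fps_nthI)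
  fix n :: nat
  have "{1..} \<inter> {..n} = {1..n}"
    by auto
  thus "fps_nth (derangement_gf s t) n = (\<Sum>k\<in>{1..} \<inter> {..n}.
      fps_nth (fps_const (derangement_poly s t k) * fps_X ^ k) n)"
    by (simp add: derangement_gf_def fps_X_power_nth sum.delta if_distrib cong: if_cong)
qed (simp add: fps_X_power_nth)

text \<open>This is the recurrence read coefficientwise; the two summands of \<open>q\<close> carry
  its two terms.\<close>

lemma derangement_gf_eq:
  fixes s t :: "'a :: comm_ring_1"
  defines "c \<equiv> fps_X * fps_const (- s * t)"
    and "q \<equiv> fps_const (- t * (1 + s)) + fps_X * fps_const (- s * t)"
  shows "derangement_gf s t = fps_X * c + fps_X * q * derangement_gf s t"
proof (rule fps_ext)
  fix n :: nat
  consider "n = 0" | "n = Suc 0" | m where "n = Suc (Suc m)"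
    by (metis not0_implies_Suc)
  thus "fps_nth (derangement_gf s t) n = fps_nth (fps_X * c + fps_X * q * derangement_gf s t) n"
  proof cases
    case 3
    \<comment> \<open>For \<open>m = 0\<close> this supplies the contribution of
      \<open>derangement_poly s t 0 = 1\<close>, which the series omits.\<close>
    have "fps_nth (fps_X * c) n = (if m = 0 then - s * t else 0)"
      by (simp add: 3 c_def)
    moreover have "fps_nth (fps_X * q * derangement_gf s t) n
        = - t * (1 + s) * fps_nth (derangement_gf s t) (Suc m) - s * t * fps_nth (derangement_gf s t) m"
      by (simp add: 3 q_def mult.assoc distrib_right)
    ultimately show ?thesis
      by (simp add: 3 derangement_gf_def derangement_poly_rec derangement_poly_0 derangement_poly_1)
  qed (simp_all add: derangement_gf_def c_def q_def mult.assoc derangement_poly_1)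
qed

text \<open>After \<open>(- t) ^ k * s * z ^ (k + 1)\<close> is pulled out, the sum is the binomial
  expansion of \<open>(s * z + (1 + s)) ^ (k - 1)\<close>.\<close>

lemma depth_term_eq:
  fixes s t z :: "'a :: comm_ring_1"
  assumes "1 \<le> k"
  shows "(- 1) ^ k * (\<Sum>i = 0..k - 1. of_nat ((k - 1) choose i) * s ^ (1 + i)
      * (1 + s) ^ (k - 1 - i) * z ^ (k + 1 + i)) * t ^ k
    = z * (- (z * s * t)) * (z * (- t * (s * z + (1 + s)))) ^ (k - 1)" (is "?l = ?r")
proof -
  obtain m where m: "k = Suc m"
    using assms by (cases k) auto
  have "?l = (- t) ^ k * s * z ^ (k + 1)
      * (\<Sum>i\<le>m. of_nat (m choose i) * (s * z) ^ i * (1 + s) ^ (m - i))"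
    unfolding sum_distrib_left sum_distrib_right
    by (intro sum.cong) (auto simp: m power_add power_mult_distrib power_minus[of t] mult_ac)
  also have "\<dots> = (- t) ^ k * s * z ^ (k + 1) * (s * z + (1 + s)) ^ m"
    by (simp only: binomial_ring)
  also have "\<dots> = z * (- (z * s * t)) * (z ^ m * ((- t) ^ m * (s * z + (1 + s)) ^ m))"
    by (simp add: m mult_ac)
  also have "\<dots> = ?r"
    by (simp only: m power_mult_distrib diff_Suc_1)
  finally show ?thesis .
qed

theorem theorem1p4:
  defines "L \<equiv> (\<lambda>n. (\<Sum>\<sigma>\<in>derangements n.
      (- 1) ^ inv_stat n \<sigma> * var_s ^ exc_stat n \<sigma> * var_t ^ depth_stat n \<sigma>) * var_z ^ n)"
    and "R \<equiv> (\<lambda>k. (- 1) ^ k * (\<Sum>i = 0..k - 1.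
      of_nat ((k - 1) choose i) * var_s ^ (1 + i) * (1 + var_s) ^ (k - 1 - i) * var_z ^ (k + 1 + i))
        * var_t ^ k)"
  shows "L summable_on {1..} \<and> R summable_on {1..} \<and>
    (\<Sum>\<^sub>\<infinity>n\<in>{1..}. L n) = (\<Sum>\<^sub>\<infinity>k\<in>{1..}. R k)"
proof -
  \<comment> \<open>These live one level below the outermost ring, where the coefficients of powers
    of \<open>z\<close> lie.\<close>
  define s t :: "int fps fps" where "s = fps_const fps_X" and "t = fps_X"
  define c where "c = fps_X * fps_const (- s * t)"
  define q where "q = fps_const (- t * (1 + s)) + fps_X * fps_const (- s * t)"
  have vars: "var_s = fps_const s" "var_t = fps_const t" "var_z = fps_X"
    by (simp_all add: var_s_def var_t_def var_z_def s_def t_def)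
  have c_eq: "c = - (var_z * var_s * var_t)"
    by (simp add: c_def vars fps_const_neg[symmetric] fps_const_mult[symmetric]
        algebra_simps del: fps_const_neg fps_const_mult)
  have q_eq: "q = - var_t * (var_s * var_z + (1 + var_s))"
    by (simp add: q_def vars fps_const_neg[symmetric] fps_const_mult[symmetric]
        fps_const_add[symmetric] algebra_simps del: fps_const_neg fps_const_mult fps_const_add)
  have "L n = fps_const (derangement_poly s t n) * fps_X ^ n" for n
    unfolding L_def vars derangement_poly_fps_const[symmetric] by (simp only: derangement_poly_def)
  hence "L = (\<lambda>n. fps_const (derangement_poly s t n) * fps_X ^ n)"
    by (rule ext)
  hence "(L has_sum derangement_gf s t) {1..}"
    using has_sum_derangement_gf by simp
  moreover have "(R has_sum derangement_gf s t) {1..}"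
  proof -
    have "R k = fps_X * c * (fps_X * q) ^ (k - 1)" if "k \<in> {1..}" for k
      using that depth_term_eq[of k var_s var_z var_t]
      unfolding R_def c_eq q_eq vars(3)[symmetric] by simp
    moreover have "((\<lambda>k. fps_X * c * (fps_X * q) ^ (k - 1)) has_sum derangement_gf s t) {1..}"
      unfolding c_def q_def by (rule has_sum_fps_geometric[OF derangement_gf_eq])
    ultimately show ?thesis
      by (rule iffD2[OF has_sum_cong])
  qed
  ultimately show ?thesis
    using infsumI has_sum_imp_summable by metis
qed

end
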